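(* Let $\kappa$ be an infinite cardinal and let $\mathbb{M}$ be a monoid of cardinality $\leqslant\kappa$. Let $\mathfrak{C}$ be a concrete category with forgetful functor $|\cdot|$ and with nice epimorphisms, and assume $\mathbf{F}$ is a left adjoint to the forgetful functor. Then $\mathbf{F}\kappa$ has an $\mathbb{M}$-action $\sigma=\mathbf{F}\zeta_\kappa$ that lifts, via nice epimorphisms, all $\mathbb{M}$-actions on $\kappa$-generated $\mathfrak{C}$-objects; that is, for every $\kappa$-generated $\mathfrak{C}$-object $A$ and every $\mathbb{M}$-action $\phi$ on $A$ there is a nice epimorphism $p\colon\mathbf{F}\kappa\to A$ such that $p\circ\sigma(m)=\phi(m)\circ p$ for every $m\in\mathbb{M}$.
   Context: Let $\mathfrak{Ens}$ be the category of nonempty sets with arbitrary mappings. A concrete category is a category $\mathfrak{C}$ with a faithful (forgetful) functor $|\cdot|\colon \mathfrak{C}\to\mathfrak{Ens}$. A left adjoint $\mathbf{F}\colon \mathfrak{Ens}\to\mathfrak{C}$ to $|\cdot|$ comes with a natural transformation $\eta_X\colon X\to|\mathbf{F}X|$ such that for every nonempty set $X$, every $\mathfrak{C}$-object $A$ and every mapping $f\colon X\to |A|$ there is a unique $\mathfrak{C}$-arrow $\widehat{f}\colon \mathbf{F}X\to A$ with $|\widehat{f}|\circ\eta_X=f$. The nice epimorphisms are the arrows of a distinguished subcategory $\mathfrak{C}^{\heartsuit}$ of $\mathfrak{C}$ satisfying: (N0) all $\mathfrak{C}^{\heartsuit}$-arrows are epimorphisms of $\mathfrak{C}$; (N1)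 every right-invertible $\mathfrak{C}$-arrow is in $\mathfrak{C}^{\heartsuit}$; (N2) if $g\circ h\in\mathfrak{C}^{\heartsuit}$ then $g\in\mathfrak{C}^{\heartsuit}$. A $\mathfrak{C}$-object $A$ is generated by a (nonempty) set $X\subseteq|A|$ if, for the inclusion $\iota\colon X\to|A|$, the arrow $\widehat{\iota}\colon\mathbf{F}X\to A$ is a nice epimorphism. $A$ is $\kappa$-generated if it is generated by a set of cardinality $\leqslant\kappa$. An $\mathbb{M}$-action on an object $A$ (of any category) is a monoid homomorphism $\phi\colon\mathbb{M}\to\operatorname{End}(A)$. If $\psi$ is an $\mathbb{M}$-action on a nonempty set $S$, then $\mathbf{F}\psi$ is the $\mathbb{M}$-action on $\mathbf{F}S$ given by $(\mathbf{F}\psi)(m)=\mathbf{F}(\psi(m))$. For a nonempty set $S$, $\zeta_S$ is the $\mathbb{M}$-action on $\mathbb{M}\times S$ defined by $\zeta_S(m)\langle a,s\rangle=\langle m\cdot a,s\rangle$. Here $|\mathbb{M}\times\kappa|=\kappa$, and $\mathbb{M}\times\kappa$ is identified with $\kappa$ via a (any fixed) bijection, so that $\zeta_\kappa$ is regarded as an $\mathbb{M}$-action on $\kappa$ and $\mathbf{F}\zeta_\kappa$ as an $\mathbb{M}$-action on $\mathbf{F}\kappa$. *)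

theory Defs
  imports "HOL-Algebra.Group" "HOL-Library.FuncSet"
begin

unbundle cardinal_syntax

section \<open>Categories, functors, natural transformations\<close>

text \<open>The composite of \<open>f\<close> and \<open>g\<close> is written \<open>g \<cdot> f\<close> (first \<open>f\<close>, then \<open>g\<close>); it is constrained
  only when \<open>Dom g = Cod f\<close>.\<close>

record ('o, 'a) cat =
  Ob :: "'o set"
  Ar :: "'a set"
  Dom :: "'a \<Rightarrow> 'o"
  Cod :: "'a \<Rightarrow> 'o"
  Ident :: "'o \<Rightarrow> 'a"
  Comp :: "'a \<Rightarrow> 'a \<Rightarrow> 'a"  (infixl "\<cdot>\<index>" 70)

definition Hom :: "('o, 'a) cat \<Rightarrow> 'o \<Rightarrow> 'o \<Rightarrow> 'a set" where
  "Hom C A B = {f \<in> Ar C. Dom C f = A \<and> Cod C f = B}"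

locale category =
  fixes C :: "('o, 'a) cat" (structure)
  assumes Dom_Ob: "f \<in> Ar C \<Longrightarrow> Dom C f \<in> Ob C"
    and Cod_Ob: "f \<in> Ar C \<Longrightarrow> Cod C f \<in> Ob C"
    and Ident_Hom: "A \<in> Ob C \<Longrightarrow> Ident C A \<in> Hom C A A"
    and Comp_Hom: "\<lbrakk>f \<in> Hom C A B; g \<in> Hom C B D\<rbrakk> \<Longrightarrow> g \<cdot> f \<in> Hom C A D"
    and Comp_Ident_left: "f \<in> Hom C A B \<Longrightarrow> Ident C B \<cdot> f = f"
    and Comp_Ident_right: "f \<in> Hom C A B \<Longrightarrow> f \<cdot> Ident C A = f"
    and Comp_assoc: "\<lbrakk>f \<in> Hom C A B; g \<in> Hom C B D; h \<in> Hom C D E\<rbrakk>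
      \<Longrightarrow> (h \<cdot> g) \<cdot> f = h \<cdot> (g \<cdot> f)"

definition epimorphism :: "('o, 'a) cat \<Rightarrow> 'a \<Rightarrow> bool" where
  "epimorphism C f \<longleftrightarrow> f \<in> Ar C \<and>
    (\<forall>B. \<forall>g \<in> Hom C (Cod C f) B. \<forall>h \<in> Hom C (Cod C f) B.
      g \<cdot>\<^bsub>C\<^esub> f = h \<cdot>\<^bsub>C\<^esub> f \<longrightarrow> g = h)"

definition right_invertible :: "('o, 'a) cat \<Rightarrow> 'a \<Rightarrow> bool" where
  "right_invertible C f \<longleftrightarrow> f \<in> Ar C \<and>
    (\<exists>g \<in> Hom C (Cod C f) (Dom C f). f \<cdot>\<^bsub>C\<^esub> g = Ident C (Cod C f))"

locale subcategory = C: category C + H: category H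
  for C :: "('o, 'a) cat" and H :: "('o, 'a) cat" +
  assumes Ob_sub: "Ob H \<subseteq> Ob C"
    and Ar_sub: "Ar H \<subseteq> Ar C"
    and Dom_eq: "f \<in> Ar H \<Longrightarrow> Dom H f = Dom C f"
    and Cod_eq: "f \<in> Ar H \<Longrightarrow> Cod H f = Cod C f"
    and Ident_eq: "A \<in> Ob H \<Longrightarrow> Ident H A = Ident C A"
    and Comp_eq: "\<lbrakk>f \<in> Ar H; g \<in> Ar H; Dom H g = Cod H f\<rbrakk> \<Longrightarrow> g \<cdot>\<^bsub>H\<^esub> f = g \<cdot>\<^bsub>C\<^esub> f"

record ('o, 'a, 'p, 'b) ftor =
  on_ob :: "'o \<Rightarrow> 'p"
  on_ar :: "'a \<Rightarrow> 'b"

locale is_functor = C: category C + D: category D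
  for C :: "('o, 'a) cat" and D :: "('p, 'b) cat" and F :: "('o, 'a, 'p, 'b) ftor" +
  assumes on_ob_Ob: "A \<in> Ob C \<Longrightarrow> on_ob F A \<in> Ob D"
    and on_ar_Hom: "f \<in> Hom C A B \<Longrightarrow> on_ar F f \<in> Hom D (on_ob F A) (on_ob F B)"
    and on_ar_Ident: "A \<in> Ob C \<Longrightarrow> on_ar F (Ident C A) = Ident D (on_ob F A)"
    and on_ar_Comp: "\<lbrakk>f \<in> Hom C A B; g \<in> Hom C B E\<rbrakk>
      \<Longrightarrow> on_ar F (g \<cdot>\<^bsub>C\<^esub> f) = on_ar F g \<cdot>\<^bsub>D\<^esub> on_ar F f"

locale faithful_functor = is_functor +
  assumes faithful: "\<lbrakk>f \<in> Hom C A B; g \<in> Hom C A B; on_ar F f = on_ar F g\<rbrakk> \<Longrightarrow> f = g"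

definition id_ftor :: "('o, 'a, 'o, 'a) ftor" where
  "id_ftor = \<lparr>on_ob = (\<lambda>A. A), on_ar = (\<lambda>f. f)\<rparr>"

definition comp_ftor ::
    "('p, 'b, 'q, 'c) ftor \<Rightarrow> ('o, 'a, 'p, 'b) ftor \<Rightarrow> ('o, 'a, 'q, 'c) ftor" where
  "comp_ftor G F = \<lparr>on_ob = on_ob G \<circ> on_ob F, on_ar = on_ar G \<circ> on_ar F\<rparr>"

locale nat_transformation = F: is_functor C D F + G: is_functor C D G
  for C :: "('o, 'a) cat" and D :: "('p, 'b) cat" and F G :: "('o, 'a, 'p, 'b) ftor"
    and \<eta> :: "'o \<Rightarrow> 'b" +
  assumes component: "A \<in> Ob C \<Longrightarrow> \<eta> A \<in> Hom D (on_ob F A) (on_ob G A)"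
    and naturality: "f \<in> Hom C A B \<Longrightarrow> on_ar G f \<cdot>\<^bsub>D\<^esub> \<eta> A = \<eta> B \<cdot>\<^bsub>D\<^esub> on_ar F f"

text \<open>\<open>F : E \<rightarrow> C\<close> is left adjoint to \<open>U : C \<rightarrow> E\<close> with unit \<open>\<eta>\<close>.\<close>

locale left_adjoint =
  F: is_functor E C F + U: is_functor C E U +
  unit: nat_transformation E E id_ftor "comp_ftor U F" \<eta>
  for E :: "('s, 'e) cat" and C :: "('o, 'a) cat"
    and F :: "('s, 'e, 'o, 'a) ftor" and U :: "('o, 'a, 's, 'e) ftor" and \<eta> :: "'s \<Rightarrow> 'e" +
  assumes universal: "\<lbrakk>X \<in> Ob E; A \<in> Ob C; f \<in> Hom E X (on_ob U A)\<rbrakk>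
    \<Longrightarrow> \<exists>!g. g \<in> Hom C (on_ob F X) A \<and> on_ar U g \<cdot>\<^bsub>E\<^esub> \<eta> X = f"

text \<open>The arrow \<open>F X \<rightarrow> A\<close> usually written as \<open>f\<close> with a hat; meaningful for
  \<open>f \<in> Hom E X (on_ob U A)\<close>.\<close>

definition hat ::
    "('s, 'e) cat \<Rightarrow> ('o, 'a) cat \<Rightarrow> ('s, 'e, 'o, 'a) ftor \<Rightarrow> ('o, 'a, 's, 'e) ftor \<Rightarrow> ('s \<Rightarrow> 'e)
      \<Rightarrow> 's \<Rightarrow> 'o \<Rightarrow> 'e \<Rightarrow> 'a" where
  "hat E C F U \<eta> X A f =
    (THE g. g \<in> Hom C (on_ob F X) A \<and> on_ar U g \<cdot>\<^bsub>E\<^esub> \<eta> X = f)"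


section \<open>Nonempty sets\<close>

text \<open>
  Sets are modelled as those subsets of a type \<open>'u\<close> that belong to a collection \<open>\<U>\<close> of ``small''
  sets; only closure under subsets is required of \<open>\<U>\<close>. The choice \<open>\<U> = UNIV\<close> is
  allowed. The parameter avoids a spurious size restriction: with \<open>\<U> = UNIV\<close>, every underlying
  set \<open>|F X|\<close> for \<open>X \<subseteq> 'u\<close>, including \<open>X = 'u\<close>, has to fit into \<open>'u\<close>, which excludes
  adjoints such as the free complete atomic Boolean algebra on \<open>X\<close>. With \<open>'u\<close> a model
  of set theory and \<open>\<U>\<close> the extensions of its elements, \<open>Ens \<U>\<close> is the category of all nonempty
  sets of that model.

  An arrow is a triple of domain, map (undefined outside the domain) and codomain.
\<close>

type_synonym 'u map_arrow = "'u set \<times> ('u \<Rightarrow> 'u) \<times> 'u set"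

definition Ens :: "'u set set \<Rightarrow> ('u set, 'u map_arrow) cat" where
  "Ens \<U> =
    \<lparr>Ob = {X \<in> \<U>. X \<noteq> {}},
     Ar = {(X, f, Y). X \<in> \<U> \<and> X \<noteq> {} \<and> Y \<in> \<U> \<and> Y \<noteq> {} \<and> f \<in> X \<rightarrow>\<^sub>E Y},
     Dom = (\<lambda>(X, f, Y). X),
     Cod = (\<lambda>(X, f, Y). Y),
     Ident = (\<lambda>X. (X, \<lambda>x\<in>X. x, X)),
     Comp = (\<lambda>(Y', g, Z) (X, f, Y). (X, compose X g f, Z))\<rparr>"

lemma category_Ens: "category (Ens \<U>)"
  by unfold_locales
    (auto simp: Ens_def Hom_def compose_def PiE_def extensional_def restrict_def fun_eq_iff Pi_iff)

definition inclusion :: "'u set \<Rightarrow> 'u set \<Rightarrow> 'u map_arrow" where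
  "inclusion X Y = (X, \<lambda>x\<in>X. x, Y)"


section \<open>Concrete categories with nice epimorphisms\<close>

locale concrete_category = faithful_functor C "Ens \<U>" U
  for \<U> :: "'u set set" and C :: "('o, 'a) cat" and U :: "('o, 'a, 'u set, 'u map_arrow) ftor" +
  assumes subset_closed: "\<lbrakk>X \<in> \<U>; Y \<subseteq> X\<rbrakk> \<Longrightarrow> Y \<in> \<U>"

text \<open>\<open>Ar H\<close> is the class of nice epimorphisms.\<close>

locale nice_epimorphisms = subcategory C H
  for C :: "('o, 'a) cat" and H :: "('o, 'a) cat" +
  assumes N0: "f \<in> Ar H \<Longrightarrow> epimorphism C f"
    and N1: "right_invertible C f \<Longrightarrow> f \<in> Ar H"
    and N2: "\<lbrakk>g \<in> Ar C; h \<in> Ar C; Dom C g = Cod C h; g \<cdot>\<^bsub>C\<^esub> h \<in> Ar H\<rbrakk> \<Longrightarrow> g \<in> Ar H"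

definition generated_by ::
    "'u set set \<Rightarrow> ('o, 'a) cat \<Rightarrow> ('o, 'a) cat \<Rightarrow> ('u set, 'u map_arrow, 'o, 'a) ftor
      \<Rightarrow> ('o, 'a, 'u set, 'u map_arrow) ftor \<Rightarrow> ('u set \<Rightarrow> 'u map_arrow)
      \<Rightarrow> 'o \<Rightarrow> 'u set \<Rightarrow> bool" where
  "generated_by \<U> C H F U \<eta> A X \<longleftrightarrow>
    A \<in> Ob C \<and> X \<noteq> {} \<and> X \<subseteq> on_ob U A \<and>
    hat (Ens \<U>) C F U \<eta> X A (inclusion X (on_ob U A)) \<in> Ar H"

definition card_generated ::
    "'u set set \<Rightarrow> ('o, 'a) cat \<Rightarrow> ('o, 'a) cat \<Rightarrow> ('u set, 'u map_arrow, 'o, 'a) ftor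
      \<Rightarrow> ('o, 'a, 'u set, 'u map_arrow) ftor \<Rightarrow> ('u set \<Rightarrow> 'u map_arrow)
      \<Rightarrow> 'k rel \<Rightarrow> 'o \<Rightarrow> bool" where
  "card_generated \<U> C H F U \<eta> \<kappa> A \<longleftrightarrow> (\<exists>X. generated_by \<U> C H F U \<eta> A X \<and> |X| \<le>o \<kappa>)"


section \<open>Monoid actions\<close>

definition End :: "('o, 'a) cat \<Rightarrow> 'o \<Rightarrow> 'a monoid" where
  "End C A = \<lparr>carrier = Hom C A A, mult = Comp C, one = Ident C A\<rparr>"

definition monoid_action ::
    "('m, 'x) monoid_scheme \<Rightarrow> ('o, 'a) cat \<Rightarrow> 'o \<Rightarrow> ('m \<Rightarrow> 'a) \<Rightarrow> bool" where
  "monoid_action M C A \<phi> \<longleftrightarrow>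
    A \<in> Ob C \<and> \<phi> \<in> hom M (End C A) \<and> \<phi> \<one>\<^bsub>M\<^esub> = \<one>\<^bsub>End C A\<^esub>"

definition ftor_action :: "('o, 'a, 'p, 'b) ftor \<Rightarrow> ('m \<Rightarrow> 'a) \<Rightarrow> 'm \<Rightarrow> 'b" where
  "ftor_action F \<psi> = (\<lambda>m. on_ar F (\<psi> m))"

definition zeta_map :: "('m, 'x) monoid_scheme \<Rightarrow> 'm \<Rightarrow> 'm \<times> 's \<Rightarrow> 'm \<times> 's" where
  "zeta_map M m = (\<lambda>(a, s). (m \<otimes>\<^bsub>M\<^esub> a, s))"

text \<open>\<open>zeta\<close> is the action \<open>zeta_map\<close> on \<open>carrier M \<times> K\<close>, regarded as an action on \<open>K\<close> via a
  bijection \<open>b\<close> from \<open>carrier M \<times> K\<close> onto \<open>K\<close>.\<close>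

definition zeta ::
    "('m, 'x) monoid_scheme \<Rightarrow> 'u set \<Rightarrow> ('m \<times> 'u \<Rightarrow> 'u) \<Rightarrow> 'm \<Rightarrow> 'u map_arrow" where
  "zeta M K b m =
    (K, \<lambda>k\<in>K. b (zeta_map M m (inv_into (carrier M \<times> K) b k)), K)"

end

theory Submission
  imports Defs
begin

text \<open>
  The \<open>\<bbbM>\<close>-set \<open>\<bbbM> \<times> K\<close> with action \<open>zeta_map\<close> is the free \<open>\<bbbM>\<close>-set on \<open>K\<close>: a map \<open>q\<close> from \<open>K\<close> into
  an \<open>\<bbbM>\<close>-set \<open>S\<close> extends along \<open>s \<mapsto> (\<one>, s)\<close> to the equivariant map sending \<open>(a, s)\<close> to \<open>a\<close> acting on
  \<open>q s\<close> (\<open>equivariant_extension\<close>). For an infinite cardinal \<open>K\<close> with \<open>|\<bbbM>| \<le> K\<close> this free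
  \<open>\<bbbM>\<close>-set can be carried by \<open>K\<close> itself.

  Let \<open>\<phi>\<close> be an action on an object \<open>A\<close> generated by a set \<open>X\<close> with at most \<open>K\<close> elements. The
  forgetful functor turns \<open>\<phi>\<close> into an action on the set \<open>|A|\<close>, so a map from \<open>K\<close> onto \<open>X\<close> extends
  to an equivariant map \<open>f : K \<rightarrow> |A|\<close>. The lifting \<open>p\<close> is the transpose of \<open>f\<close> under the
  adjunction. Two properties of transposition finish the proof.

  Transposition is natural in both arguments, hence carries equivariant maps to equivariant
  arrows (\<open>hat_equivariant\<close>). Moreover, \<open>f\<close> takes every \<open>x \<in> X\<close> as a value, namely at
  the element of \<open>K\<close> that stands for some \<open>(\<one>, s)\<close> with \<open>q s = x\<close>; so the inclusion of \<open>X\<close> into \<open>|A|\<close> factors through \<open>f\<close>, and therefore its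
  transpose, a nice epimorphism because \<open>X\<close> generates \<open>A\<close>, factors through \<open>p\<close>. The cancellation
  axiom \<open>N2\<close> makes \<open>p\<close> nice (\<open>hat_nice_if_factor\<close>).
\<close>

section \<open>Actions and functors\<close>

lemma monoid_action_iff:
  "monoid_action M C A \<phi> \<longleftrightarrow>
    A \<in> Ob C \<and> (\<forall>m \<in> carrier M. \<phi> m \<in> Hom C A A) \<and>
    (\<forall>m \<in> carrier M. \<forall>n \<in> carrier M. \<phi> (m \<otimes>\<^bsub>M\<^esub> n) = \<phi> m \<cdot>\<^bsub>C\<^esub> \<phi> n) \<and>
    \<phi> \<one>\<^bsub>M\<^esub> = Ident C A"
  by (auto simp: monoid_action_def End_def hom_def)

lemma (in is_functor) ftor_action:
  assumes "monoid_action M C A \<phi>"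
  shows "monoid_action M D (on_ob F A) (ftor_action F \<phi>)"
proof -
  have A: "A \<in> Ob C" and \<phi>: "\<And>m. m \<in> carrier M \<Longrightarrow> \<phi> m \<in> Hom C A A"
    and mult: "\<And>m n. \<lbrakk>m \<in> carrier M; n \<in> carrier M\<rbrakk> \<Longrightarrow> \<phi> (m \<otimes>\<^bsub>M\<^esub> n) = \<phi> m \<cdot>\<^bsub>C\<^esub> \<phi> n"
    and one: "\<phi> \<one>\<^bsub>M\<^esub> = Ident C A"
    using assms by (auto simp: monoid_action_iff)
  show ?thesis
    unfolding monoid_action_iff ftor_action_def
    using on_ob_Ob[OF A] on_ar_Hom[OF \<phi>] on_ar_Comp[OF \<phi> \<phi>] on_ar_Ident[OF A]
    by (simp add: mult one)
qed


section \<open>Transposition along an adjunction\<close>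

context left_adjoint
begin

lemma hat_Hom_and_unit:
  assumes A: "A \<in> Ob C" and f: "f \<in> Hom E X (on_ob U A)"
  shows "hat E C F U \<eta> X A f \<in> Hom C (on_ob F X) A"
    and "on_ar U (hat E C F U \<eta> X A f) \<cdot>\<^bsub>E\<^esub> \<eta> X = f"
proof -
  have "X \<in> Ob E"
    using f F.C.Dom_Ob by (auto simp: Hom_def)
  from theI'[OF universal[OF this A f]]
  show "hat E C F U \<eta> X A f \<in> Hom C (on_ob F X) A"
    and "on_ar U (hat E C F U \<eta> X A f) \<cdot>\<^bsub>E\<^esub> \<eta> X = f"
    by (auto simp: hat_def)
qed

lemma hat_eqI:
  assumes X: "X \<in> Ob E" and A: "A \<in> Ob C" and g: "g \<in> Hom C (on_ob F X) A"
  shows "hat E C F U \<eta> X A (on_ar U g \<cdot>\<^bsub>E\<^esub> \<eta> X) = g"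
proof -
  have "\<eta> X \<in> Hom E X (on_ob U (on_ob F X))"
    using unit.component[OF X] by (simp add: id_ftor_def comp_ftor_def)
  then have "on_ar U g \<cdot>\<^bsub>E\<^esub> \<eta> X \<in> Hom E X (on_ob U A)"
    using U.on_ar_Hom[OF g] by (rule F.C.Comp_Hom)
  from the1_equality[OF universal[OF X A this]] g show ?thesis
    by (simp add: hat_def)
qed

lemma hat_precompose:
  assumes A: "A \<in> Ob C" and f: "f \<in> Hom E Y (on_ob U A)" and i: "i \<in> Hom E X Y"
  shows "hat E C F U \<eta> Y A f \<cdot>\<^bsub>C\<^esub> on_ar F i = hat E C F U \<eta> X A (f \<cdot>\<^bsub>E\<^esub> i)"
proof -
  let ?p = "hat E C F U \<eta> Y A f"
  note p = hat_Hom_and_unit[OF A f]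
  have X: "X \<in> Ob E" and Y: "Y \<in> Ob E"
    using i F.C.Dom_Ob F.C.Cod_Ob by (auto simp: Hom_def)
  have \<eta>: "\<eta> Z \<in> Hom E Z (on_ob U (on_ob F Z))" if "Z \<in> Ob E" for Z
    using unit.component[OF that] by (simp add: id_ftor_def comp_ftor_def)
  have nat: "on_ar U (on_ar F i) \<cdot>\<^bsub>E\<^esub> \<eta> X = \<eta> Y \<cdot>\<^bsub>E\<^esub> i"
    using unit.naturality[OF i] by (simp add: id_ftor_def comp_ftor_def)
  note Fi = F.on_ar_Hom[OF i]
  have "on_ar U (?p \<cdot>\<^bsub>C\<^esub> on_ar F i) \<cdot>\<^bsub>E\<^esub> \<eta> X
      = on_ar U ?p \<cdot>\<^bsub>E\<^esub> (on_ar U (on_ar F i) \<cdot>\<^bsub>E\<^esub> \<eta> X)"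
    by (simp add: U.on_ar_Comp[OF Fi p(1)]
      F.C.Comp_assoc[OF \<eta>[OF X] U.on_ar_Hom[OF Fi] U.on_ar_Hom[OF p(1)]])
  also have "\<dots> = on_ar U ?p \<cdot>\<^bsub>E\<^esub> \<eta> Y \<cdot>\<^bsub>E\<^esub> i"
    by (simp add: nat F.C.Comp_assoc[OF i \<eta>[OF Y] U.on_ar_Hom[OF p(1)]])
  finally have "on_ar U (?p \<cdot>\<^bsub>C\<^esub> on_ar F i) \<cdot>\<^bsub>E\<^esub> \<eta> X = f \<cdot>\<^bsub>E\<^esub> i"
    by (simp add: p(2))
  with hat_eqI[OF X A F.D.Comp_Hom[OF Fi p(1)]] show ?thesis
    by simp
qed

lemma hat_postcompose:
  assumes A: "A \<in> Ob C" and f: "f \<in> Hom E X (on_ob U A)" and g: "g \<in> Hom C A B"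
  shows "g \<cdot>\<^bsub>C\<^esub> hat E C F U \<eta> X A f = hat E C F U \<eta> X B (on_ar U g \<cdot>\<^bsub>E\<^esub> f)"
proof -
  let ?p = "hat E C F U \<eta> X A f"
  note p = hat_Hom_and_unit[OF A f]
  have X: "X \<in> Ob E" and B: "B \<in> Ob C"
    using f g F.C.Dom_Ob F.D.Cod_Ob by (auto simp: Hom_def)
  have \<eta>: "\<eta> X \<in> Hom E X (on_ob U (on_ob F X))"
    using unit.component[OF X] by (simp add: id_ftor_def comp_ftor_def)
  have "on_ar U (g \<cdot>\<^bsub>C\<^esub> ?p) \<cdot>\<^bsub>E\<^esub> \<eta> X = on_ar U g \<cdot>\<^bsub>E\<^esub> f"
    by (simp add: U.on_ar_Comp[OF p(1) g] p(2)
      F.C.Comp_assoc[OF \<eta> U.on_ar_Hom[OF p(1)] U.on_ar_Hom[OF g]])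
  with hat_eqI[OF X B F.D.Comp_Hom[OF p(1) g]] show ?thesis
    by simp
qed

text \<open>Both composites are transposes, of \<open>f \<cdot> \<psi> m\<close> and of \<open>|\<phi> m| \<cdot> f\<close>, by naturality of
  transposition in each of its two arguments.\<close>

lemma hat_equivariant:
  assumes A: "A \<in> Ob C" and f: "f \<in> Hom E X (on_ob U A)"
    and "\<psi> m \<in> Hom E X X" and "\<phi> m \<in> Hom C A A"
    and "f \<cdot>\<^bsub>E\<^esub> \<psi> m = ftor_action U \<phi> m \<cdot>\<^bsub>E\<^esub> f"
  shows "hat E C F U \<eta> X A f \<cdot>\<^bsub>C\<^esub> ftor_action F \<psi> m = \<phi> m \<cdot>\<^bsub>C\<^esub> hat E C F U \<eta> X A f"
  using assms hat_precompose[OF A f, of "\<psi> m" X] hat_postcompose[OF A f, of "\<phi> m" A]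
  by (simp add: ftor_action_def)

text \<open>The transpose of \<open>f \<cdot> i\<close> is the transpose of \<open>f\<close> preceded by \<open>F i\<close>, so the
  cancellation axiom \<open>N2\<close> applies.\<close>

lemma hat_nice_if_factor:
  assumes "nice_epimorphisms C H"
    and A: "A \<in> Ob C" and f: "f \<in> Hom E Y (on_ob U A)" and i: "i \<in> Hom E X Y"
    and nice: "hat E C F U \<eta> X A (f \<cdot>\<^bsub>E\<^esub> i) \<in> Ar H"
  shows "hat E C F U \<eta> Y A f \<in> Ar H"
proof (rule nice_epimorphisms.N2[OF assms(1)])
  show "hat E C F U \<eta> Y A f \<cdot>\<^bsub>C\<^esub> on_ar F i \<in> Ar H"
    using nice by (simp add: hat_precompose[OF A f i])
qed (use hat_Hom_and_unit(1)[OF A f] F.on_ar_Hom[OF i] in \<open>auto simp: Hom_def\<close>)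

end


section \<open>Free actions on sets\<close>

lemma Ob_Ens: "X \<in> Ob (Ens \<U>) \<longleftrightarrow> X \<in> \<U> \<and> X \<noteq> {}"
  by (simp add: Ens_def)

lemma Hom_Ens:
  "t \<in> Hom (Ens \<U>) X Y \<longleftrightarrow>
    X \<in> Ob (Ens \<U>) \<and> Y \<in> Ob (Ens \<U>) \<and> (\<exists>f \<in> X \<rightarrow>\<^sub>E Y. t = (X, f, Y))"
  by (auto simp: Ens_def Hom_def)

lemma Comp_Ens: "(Y', g, Z) \<cdot>\<^bsub>Ens \<U>\<^esub> (X, f, Y) = (X, compose X g f, Z)"
  by (simp add: Ens_def)

lemma Ident_Ens: "Ident (Ens \<U>) X = (X, \<lambda>x\<in>X. x, X)"
  by (simp add: Ens_def)

lemma bij_betw_Times_Field_exists: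
  assumes "Card_order \<kappa>" and "infinite (Field \<kappa>)" and "A \<noteq> {}" and "|A| \<le>o \<kappa>"
  shows "\<exists>b. bij_betw b (A \<times> Field \<kappa>) (Field \<kappa>)"
proof -
  have "|A| \<le>o |Field \<kappa>|"
    using assms(4) ordIso_symmetric[OF card_of_Field_ordIso[OF assms(1)]]
    by (rule ordLeq_ordIso_trans)
  with assms(2,3) have "|A \<times> Field \<kappa>| =o |Field \<kappa>|"
    using card_of_Times_infinite[of "Field \<kappa>" A] by simp
  then show ?thesis
    by (simp add: card_of_ordIso)
qed

lemma bij_betw_Times_E:
  assumes "bij_betw b (A \<times> B) K" and "k \<in> K"
  obtains a s where "a \<in> A" "s \<in> B" "k = b (a, s)"
proof -
  from assms have "k \<in> b ` (A \<times> B)"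
    by (simp add: bij_betw_imp_surj_on)
  then show thesis
    using that by (elim imageE SigmaE) simp
qed

lemma zeta_Hom:
  assumes "monoid M" and b: "bij_betw b (carrier M \<times> K) K"
    and K: "K \<in> Ob (Ens \<U>)" and m: "m \<in> carrier M"
  shows "zeta M K b m \<in> Hom (Ens \<U>) K K"
proof -
  have "b (zeta_map M m (inv_into (carrier M \<times> K) b k)) \<in> K" if k: "k \<in> K" for k
  proof -
    obtain a s where as: "a \<in> carrier M" "s \<in> K" "k = b (a, s)"
      using bij_betw_Times_E[OF b k] by blast
    then have "(m \<otimes>\<^bsub>M\<^esub> a, s) \<in> carrier M \<times> K"
      using monoid.m_closed[OF assms(1) m] by simp
    with as show ?thesis
      using bij_betw_apply[OF b] by (simp add: zeta_map_def bij_betw_inv_into_left[OF b])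
  qed
  with K show ?thesis
    by (auto simp: Hom_Ens zeta_def)
qed

text \<open>Since \<open>b\<close> is onto \<open>K\<close>, this rule determines \<open>zeta\<close> and frees the arguments below from the
  inverse of \<open>b\<close>.\<close>

lemma zeta_coordinates:
  assumes "monoid M" and b: "bij_betw b (carrier M \<times> K) K"
    and "m \<in> carrier M" and "a \<in> carrier M" and "s \<in> K"
  shows "fst (snd (zeta M K b m)) (b (a, s)) = b (m \<otimes>\<^bsub>M\<^esub> a, s)"
  using assms(3-5) bij_betw_apply[OF b, of "(a, s)"]
  by (simp add: zeta_def zeta_map_def bij_betw_inv_into_left[OF b])

lemma monoid_action_zeta:
  assumes M: "monoid M" and b: "bij_betw b (carrier M \<times> K) K" and K: "K \<in> Ob (Ens \<U>)"
  shows "monoid_action M (Ens \<U>) K (zeta M K b)"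
  unfolding monoid_action_iff
proof (intro conjI ballI)
  interpret monoid M by fact
  have ext: "f = g" if fg: "f \<in> Hom (Ens \<U>) K K" "g \<in> Hom (Ens \<U>) K K"
    and eq: "\<And>a s. \<lbrakk>a \<in> carrier M; s \<in> K\<rbrakk> \<Longrightarrow> fst (snd f) (b (a, s)) = fst (snd g) (b (a, s))"
    for f g
  proof -
    have "fst (snd f) k = fst (snd g) k" if "k \<in> K" for k
      by (rule bij_betw_Times_E[OF b that]) (simp add: eq)
    with fg show ?thesis
      by (auto simp: Hom_Ens intro: PiE_ext)
  qed
  note zeta = zeta_Hom[OF M b K] zeta_coordinates[OF M b]
  show "K \<in> Ob (Ens \<U>)" by fact
  show "zeta M K b m \<in> Hom (Ens \<U>) K K" if "m \<in> carrier M" for m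
    by (rule zeta(1)[OF that])
  show "zeta M K b (m \<otimes>\<^bsub>M\<^esub> n) = zeta M K b m \<cdot>\<^bsub>Ens \<U>\<^esub> zeta M K b n"
    if m: "m \<in> carrier M" and n: "n \<in> carrier M" for m n
  proof (rule ext)
    show "zeta M K b m \<cdot>\<^bsub>Ens \<U>\<^esub> zeta M K b n \<in> Hom (Ens \<U>) K K"
      using category.Comp_Hom[OF category_Ens zeta(1)[OF n] zeta(1)[OF m]] .
    fix a s assume as: "a \<in> carrier M" "s \<in> K"
    obtain f g where fg: "zeta M K b m = (K, f, K)" "zeta M K b n = (K, g, K)"
      using zeta(1)[OF m] zeta(1)[OF n] by (auto simp: Hom_Ens)
    have "b (a, s) \<in> K"
      using bij_betw_apply[OF b] as by auto
    with as m n zeta(2)[OF m] zeta(2)[OF n]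
    show "fst (snd (zeta M K b (m \<otimes>\<^bsub>M\<^esub> n))) (b (a, s)) =
        fst (snd (zeta M K b m \<cdot>\<^bsub>Ens \<U>\<^esub> zeta M K b n)) (b (a, s))"
      by (simp add: zeta(2) fg Comp_Ens compose_def m_assoc)
  qed (use m n zeta(1) in auto)
  show "zeta M K b \<one>\<^bsub>M\<^esub> = Ident (Ens \<U>) K"
  proof (rule ext)
    show "Ident (Ens \<U>) K \<in> Hom (Ens \<U>) K K"
      using category.Ident_Hom[OF category_Ens K] .
    fix a s assume as: "a \<in> carrier M" "s \<in> K"
    then have "b (a, s) \<in> K"
      using bij_betw_apply[OF b] by auto
    with as show "fst (snd (zeta M K b \<one>\<^bsub>M\<^esub>)) (b (a, s)) = fst (snd (Ident (Ens \<U>) K)) (b (a, s))"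
      by (simp add: zeta(2) Ident_Ens)
  qed (simp add: zeta(1))
qed

text \<open>This is the freeness of \<open>zeta\<close> on the elements \<open>b (\<one>, s)\<close>: the extension of \<open>q\<close> sends
  \<open>b (a, s)\<close> to \<open>\<psi> a\<close> applied to \<open>q s\<close>, and multiplicativity of \<open>\<psi>\<close> is equivariance.\<close>

lemma equivariant_extension:
  assumes M: "monoid M" and b: "bij_betw b (carrier M \<times> K) K" and K: "K \<in> Ob (Ens \<U>)"
    and \<psi>: "monoid_action M (Ens \<U>) S \<psi>" and q: "q \<in> K \<rightarrow> S"
  obtains f where "f \<in> K \<rightarrow>\<^sub>E S"
    and "\<And>m. m \<in> carrier M \<Longrightarrow> (K, f, S) \<cdot>\<^bsub>Ens \<U>\<^esub> zeta M K b m = \<psi> m \<cdot>\<^bsub>Ens \<U>\<^esub> (K, f, S)"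
    and "\<And>s. s \<in> K \<Longrightarrow> f (b (\<one>\<^bsub>M\<^esub>, s)) = q s"
proof -
  interpret monoid M by fact
  define act where "act m = fst (snd (\<psi> m))" for m
  have \<psi>_act: "\<psi> m = (S, act m, S)" and act: "act m \<in> S \<rightarrow>\<^sub>E S" if "m \<in> carrier M" for m
  proof -
    have "\<psi> m \<in> Hom (Ens \<U>) S S"
      using \<psi> that by (simp add: monoid_action_iff)
    then show "\<psi> m = (S, act m, S)" "act m \<in> S \<rightarrow>\<^sub>E S"
      unfolding Hom_Ens act_def by auto
  qed
  have act_mult: "act (m \<otimes>\<^bsub>M\<^esub> n) x = act m (act n x)"
    if "m \<in> carrier M" "n \<in> carrier M" "x \<in> S" for m n x
  proof -
    have "\<psi> (m \<otimes>\<^bsub>M\<^esub> n) = \<psi> m \<cdot>\<^bsub>Ens \<U>\<^esub> \<psi> n"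
      using \<psi> that by (simp add: monoid_action_iff)
    with that show ?thesis
      by (simp add: \<psi>_act Comp_Ens compose_def)
  qed
  have act_one: "act \<one>\<^bsub>M\<^esub> x = x" if "x \<in> S" for x
    using \<psi> that by (simp add: monoid_action_iff Ident_Ens act_def)
  define f where
    "f = (\<lambda>k\<in>K. case inv_into (carrier M \<times> K) b k of (a, s) \<Rightarrow> act a (q s))"
  have bK: "b (a, s) \<in> K" if "a \<in> carrier M" "s \<in> K" for a s
    using bij_betw_apply[OF b] that by auto
  have f_b: "f (b (a, s)) = act a (q s)" if "a \<in> carrier M" "s \<in> K" for a s
    using that bK by (simp add: f_def bij_betw_inv_into_left[OF b])
  show thesis
  proof
    have "f k \<in> S" if k: "k \<in> K" for k
    proof -
      obtain a s where as: "a \<in> carrier M" "s \<in> K" "k = b (a, s)"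
        using bij_betw_Times_E[OF b k] by blast
      with q act[OF as(1)] show ?thesis
        by (auto simp: f_b)
    qed
    then show "f \<in> K \<rightarrow>\<^sub>E S"
      by (auto simp: f_def)
    show "f (b (\<one>\<^bsub>M\<^esub>, s)) = q s" if "s \<in> K" for s
      using that by (simp add: f_b act_one[OF funcset_mem[OF q]])
    fix m assume m: "m \<in> carrier M"
    obtain z where z: "zeta M K b m = (K, z, K)"
      using zeta_Hom[OF M b K m] by (auto simp: Hom_Ens)
    have "f (z k) = act m (f k)" if k: "k \<in> K" for k
    proof -
      obtain a s where as: "a \<in> carrier M" "s \<in> K" "k = b (a, s)"
        using bij_betw_Times_E[OF b k] by blast
      moreover have "z (b (a, s)) = b (m \<otimes>\<^bsub>M\<^esub> a, s)"
        using zeta_coordinates[OF M b m as(1,2)] by (simp add: z)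
      ultimately show ?thesis
        using m by (simp add: f_b act_mult funcset_mem[OF q])
    qed
    then show "(K, f, S) \<cdot>\<^bsub>Ens \<U>\<^esub> zeta M K b m = \<psi> m \<cdot>\<^bsub>Ens \<U>\<^esub> (K, f, S)"
      by (auto simp: z \<psi>_act[OF m] Comp_Ens compose_def intro: restrict_ext)
  qed
qed


section \<open>Lifting actions to the free object\<close>

text \<open>The bound on \<open>X\<close> supplies a map of \<open>K\<close> onto \<open>X\<close>. The lifting is the transpose of the
  equivariant extension of that map.\<close>

lemma zeta_lifts_action:
  assumes concrete: "concrete_category \<U> C U" and nice: "nice_epimorphisms C H"
    and adj: "left_adjoint (Ens \<U>) C F U \<eta>"
    and M: "monoid M" and b: "bij_betw b (carrier M \<times> K) K" and K: "K \<in> Ob (Ens \<U>)"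
    and gen: "generated_by \<U> C H F U \<eta> A X" and card: "|X| \<le>o |K|"
    and \<phi>: "monoid_action M C A \<phi>"
  shows "\<exists>p \<in> Hom C (on_ob F K) A. p \<in> Ar H \<and>
    (\<forall>m \<in> carrier M. p \<cdot>\<^bsub>C\<^esub> ftor_action F (zeta M K b) m = \<phi> m \<cdot>\<^bsub>C\<^esub> p)"
proof -
  interpret concrete_category \<U> C U by fact
  interpret left_adjoint "Ens \<U>" C F U \<eta> by fact
  let ?S = "on_ob U A"
  have A: "A \<in> Ob C" and X: "X \<noteq> {}" "X \<subseteq> ?S"
    and hat_incl: "hat (Ens \<U>) C F U \<eta> X A (inclusion X ?S) \<in> Ar H"
    using gen by (auto simp: generated_by_def)
  have S: "?S \<in> Ob (Ens \<U>)"
    using A by (rule on_ob_Ob)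
  with X have X_Ob: "X \<in> Ob (Ens \<U>)"
    using subset_closed[of ?S X] by (simp add: Ob_Ens)
  obtain q where q: "q ` K = X"
    using iffD2[OF card_of_ordLeq2[OF X(1)] card] by (elim exE)
  with X have qS: "q \<in> K \<rightarrow> ?S"
    by auto
  obtain f where f: "f \<in> K \<rightarrow>\<^sub>E ?S"
    and equi: "\<And>m. m \<in> carrier M \<Longrightarrow>
      (K, f, ?S) \<cdot>\<^bsub>Ens \<U>\<^esub> zeta M K b m = ftor_action U \<phi> m \<cdot>\<^bsub>Ens \<U>\<^esub> (K, f, ?S)"
    and f_one: "\<And>s. s \<in> K \<Longrightarrow> f (b (\<one>\<^bsub>M\<^esub>, s)) = q s"
    by (rule equivariant_extension[OF M b K ftor_action[OF \<phi>] qS]) (rule that; assumption)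
  have f_Hom: "(K, f, ?S) \<in> Hom (Ens \<U>) K ?S"
    using f K S by (simp add: Hom_Ens)
  \<comment> \<open>A section of \<open>f\<close> over \<open>X\<close>, through which the inclusion of \<open>X\<close> factors.\<close>
  define i where "i = (\<lambda>x\<in>X. b (\<one>\<^bsub>M\<^esub>, inv_into K q x))"
  have sec: "inv_into K q x \<in> K" "q (inv_into K q x) = x" if "x \<in> X" for x
    using that q by (auto simp: inv_into_into f_inv_into_f)
  have "i \<in> X \<rightarrow>\<^sub>E K"
    using sec(1) monoid.one_closed[OF M] bij_betw_apply[OF b] by (auto simp: i_def)
  with X_Ob K have i_Hom: "(X, i, K) \<in> Hom (Ens \<U>) X K"
    by (simp add: Hom_Ens)
  have factor: "(K, f, ?S) \<cdot>\<^bsub>Ens \<U>\<^esub> (X, i, K) = inclusion X ?S"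
    using sec by (auto simp: Comp_Ens inclusion_def compose_def i_def f_one intro: restrict_ext)
  let ?p = "hat (Ens \<U>) C F U \<eta> K A (K, f, ?S)"
  have "?p \<in> Ar H"
    using hat_nice_if_factor[OF nice A f_Hom i_Hom] hat_incl by (simp add: factor)
  moreover have "?p \<cdot>\<^bsub>C\<^esub> ftor_action F (zeta M K b) m = \<phi> m \<cdot>\<^bsub>C\<^esub> ?p" if m: "m \<in> carrier M" for m
  proof (rule hat_equivariant[OF A f_Hom])
    show "\<phi> m \<in> Hom C A A"
      using \<phi> m by (simp add: monoid_action_iff)
  qed (fact zeta_Hom[OF M b K m], fact equi[OF m])
  ultimately show ?thesis
    using hat_Hom_and_unit(1)[OF A f_Hom] by blast
qed

theorem theorem4p4:
  fixes \<U> :: "'u set set"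
    and C H :: "('o, 'a) cat"
    and U :: "('o, 'a, 'u set, 'u map_arrow) ftor"
    and F :: "('u set, 'u map_arrow, 'o, 'a) ftor"
    and \<eta> :: "'u set \<Rightarrow> 'u map_arrow"
    and M :: "('m, 'x) monoid_scheme"
    and \<kappa> :: "'u rel"
  assumes "concrete_category \<U> C U"
    and "nice_epimorphisms C H"
    and "left_adjoint (Ens \<U>) C F U \<eta>"
    and "Card_order \<kappa>" and "infinite (Field \<kappa>)" and "Field \<kappa> \<in> \<U>"
    and "monoid M" and "|carrier M| \<le>o \<kappa>"
  shows "(\<exists>b. bij_betw b (carrier M \<times> Field \<kappa>) (Field \<kappa>)) \<and>
    (\<forall>b. bij_betw b (carrier M \<times> Field \<kappa>) (Field \<kappa>) \<longrightarrow>
      (let K = Field \<kappa>; \<sigma> = ftor_action F (zeta M K b) in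
        monoid_action M (Ens \<U>) K (zeta M K b) \<and>
        monoid_action M C (on_ob F K) \<sigma> \<and>
        (\<forall>A \<phi>. card_generated \<U> C H F U \<eta> \<kappa> A \<and> monoid_action M C A \<phi> \<longrightarrow>
          (\<exists>p \<in> Hom C (on_ob F K) A. p \<in> Ar H \<and>
            (\<forall>m \<in> carrier M. p \<cdot>\<^bsub>C\<^esub> \<sigma> m = \<phi> m \<cdot>\<^bsub>C\<^esub> p)))))"
proof (unfold Let_def, intro conjI allI impI)
  have "carrier M \<noteq> {}"
    using monoid.one_closed[OF assms(7)] by blast
  then show "\<exists>b. bij_betw b (carrier M \<times> Field \<kappa>) (Field \<kappa>)"
    using assms(4,5,8) by (intro bij_betw_Times_Field_exists)
next
  have K: "Field \<kappa> \<in> Ob (Ens \<U>)"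
    using assms(5,6) by (auto simp: Ob_Ens)
  fix b assume b: "bij_betw b (carrier M \<times> Field \<kappa>) (Field \<kappa>)"
  show zeta: "monoid_action M (Ens \<U>) (Field \<kappa>) (zeta M (Field \<kappa>) b)"
    by (rule monoid_action_zeta[OF assms(7) b K])
  show "monoid_action M C (on_ob F (Field \<kappa>)) (ftor_action F (zeta M (Field \<kappa>) b))"
    using is_functor.ftor_action[OF left_adjoint.axioms(1)[OF assms(3)] zeta] .
  fix A \<phi> assume A: "card_generated \<U> C H F U \<eta> \<kappa> A \<and> monoid_action M C A \<phi>"
  then obtain X where X: "generated_by \<U> C H F U \<eta> A X" "|X| \<le>o \<kappa>"
    by (auto simp: card_generated_def)
  have "|X| \<le>o |Field \<kappa>|"
    using X(2) ordIso_symmetric[OF card_of_Field_ordIso[OF assms(4)]]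
    by (rule ordLeq_ordIso_trans)
  show "\<exists>p \<in> Hom C (on_ob F (Field \<kappa>)) A. p \<in> Ar H \<and>
      (\<forall>m \<in> carrier M. p \<cdot>\<^bsub>C\<^esub> ftor_action F (zeta M (Field \<kappa>) b) m = \<phi> m \<cdot>\<^bsub>C\<^esub> p)"
    using A by (intro zeta_lifts_action[OF assms(1-3,7) b K X(1) \<open>|X| \<le>o |Field \<kappa>|\<close>]) simp
qed

end
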